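(* Let $N$ be a positive integer. For an integer $n\ge 1$, let $$\lambda_n(N):=F_n\cdot[\overline{2N,\,1^{(n-1)}}].$$ Then $\lambda_n(N)$ is an algebraic integer. Moreover, if $n$ is odd, then $$\lambda_n(N)=[\tilde F_{n+1}(2N),\overline{2\tilde F_{n+1}(N)}],$$ and if $n$ is even, then $$\lambda_n(N)=[\tilde F_{n+1}(2N)-1,\overline{1,\,2\tilde F_{n+1}(N)-2}].$$
   Context: $F_n$ denotes the Fibonacci numbers: $F_0=0$, $F_1=F_2=1$, $F_{n+1}=F_n+F_{n-1}$. For a positive integer $m$, the Fibonacci-like numbers $\tilde F_n(m)$ are defined by $\tilde F_0(m)=0$, $\tilde F_1(m)=1$, $\tilde F_2(m)=m$ and $\tilde F_n(m)=\tilde F_{n-1}(m)+\tilde F_{n-2}(m)$ for $n\ge 3$; equivalently $\tilde F_{n+1}(m)=mF_n+F_{n-1}$ for $n\ge 1$. The notation $[a_0,a_1,a_2,\dots]$ denotes the continued fraction $a_0+\cfrac{1}{a_1+\cfrac{1}{a_2+\cdots}}$ (an infinite one is the limit of its convergents), and $[a_0,\dots,a_r,\overline{b_1,\dots,b_s}]$ (or $[\overline{b_1,\dots,b_s}]$ in the purely periodic case) denotes the periodic continued fraction in which the block $b_1,\dots,b_s$ is repeated indefinitely. $1^{(j)}$ denotes the string $1,1,\dots,1$ of $j$ ones (empty if $j=0$). *)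

theory Defs
  imports
    "HOL-Analysis.Analysis"
    "HOL-Computational_Algebra.Polynomial"
    "HOL-Number_Theory.Fib"
    "HOL-Library.Stream"
begin

fun fib_like :: "nat \<Rightarrow> nat \<Rightarrow> nat" where
  "fib_like m 0 = 0"
| "fib_like m (Suc 0) = 1"
| "fib_like m (Suc (Suc 0)) = m"
| "fib_like m (Suc (Suc (Suc n))) = fib_like m (Suc (Suc n)) + fib_like m (Suc n)"

text \<open>
  \<open>cfrac_conv s k\<close> is the convergent \<open>[s_0, ..., s_k]\<close>. It is meaningful as long as no
  denominator vanishes, in particular whenever all partial quotients are positive.
  A periodic continued fraction with preperiod \<open>as\<close> and period \<open>bs\<close> (nonempty) is given by
  the stream \<open>as @- cycle bs\<close>.
\<close>

primrec cfrac_conv :: "int stream \<Rightarrow> nat \<Rightarrow> real" where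
  "cfrac_conv s 0 = of_int (shd s)"
| "cfrac_conv s (Suc k) = of_int (shd s) + 1 / cfrac_conv (stl s) k"

text \<open>Unspecified if the convergents do not converge.\<close>

definition cfrac :: "int stream \<Rightarrow> real" where
  "cfrac s = lim (cfrac_conv s)"

definition lam_quotients :: "nat \<Rightarrow> nat \<Rightarrow> int stream" where
  "lam_quotients n N = cycle (2 * int N # replicate (n - 1) 1)"

definition lam :: "nat \<Rightarrow> nat \<Rightarrow> real" where
  "lam n N = real (fib n) * cfrac (lam_quotients n N)"

end

theory Submission
  imports Defs
begin

text \<open>
  Write \<open>a = F\<^sub>n\<close>, \<open>b = F\<^sub>n\<^sub>-\<^sub>1\<close> and \<open>T = N a + b\<close>. Appending a tail \<open>x\<close> to a block of ones acts as a
  Moebius map with Fibonacci coefficients, so periodicity turns into a quadratic equation for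
  the continued fraction, and completing the square with Cassini's identity gives
  \<open>(\<lambda>\<^sub>n - N a)\<^sup>2 = T\<^sup>2 - (-1)\<^sup>n\<close>. The two claimed expansions satisfy the same equation,
  and all values exceed \<open>N a\<close>.
\<close>

section \<open>Convergence for positive partial quotients\<close>

lemma cfrac_conv_ge_1:
  assumes "\<forall>a\<in>sset s. a \<ge> 1"
  shows "cfrac_conv s k \<ge> 1"
  using assms
proof (induction k arbitrary: s)
  case 0
  then show ?case by (simp add: shd_sset)
next
  case (Suc k)
  have "cfrac_conv (stl s) k \<ge> 1"
    using Suc by (metis stl_sset)
  moreover have "shd s \<ge> 1"
    using Suc.prems shd_sset by blast
  ultimately show ?case by (simp add: add_increasing2)
qed

text \<open>
  Two steps are taken at once because a single step \<open>x \<mapsto> a + 1 / x\<close> contracts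
  distances on \<open>[1, \<infinity>)\<close> by no fixed factor below 1.
\<close>

lemma cfrac_step_contraction:
  fixes b x y :: real
  assumes "b \<ge> 1" "x \<ge> 1" "y \<ge> 1"
  shows "\<bar>1 / (b + 1 / x) - 1 / (b + 1 / y)\<bar> \<le> \<bar>x - y\<bar> / 4"
proof -
  have bx_ge: "b * x + 1 \<ge> 2" and by_ge: "b * y + 1 \<ge> 2"
    using mult_mono[of 1 b 1 x] mult_mono[of 1 b 1 y] assms by auto
  have "1 / (b + 1 / x) - 1 / (b + 1 / y) = x / (b * x + 1) - y / (b * y + 1)"
    using assms by (simp add: field_simps)
  also have "\<dots> = (x - y) / ((b * x + 1) * (b * y + 1))"
    using bx_ge by_ge by (simp add: field_simps)
  finally have "\<bar>1 / (b + 1 / x) - 1 / (b + 1 / y)\<bar> = \<bar>x - y\<bar> / ((b * x + 1) * (b * y + 1))"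
    using bx_ge by_ge by (simp add: abs_mult)
  moreover have "(b * x + 1) * (b * y + 1) \<ge> 4"
    using mult_mono[OF bx_ge by_ge] bx_ge by simp
  ultimately show ?thesis
    by (metis abs_ge_zero frac_le order_refl zero_less_numeral)
qed

text \<open>Every two partial quotients peeled off gain a factor \<open>1 / 4\<close>. The
  \<open>Suc\<close> leaves at least one quotient after the leading one at the end, so both
  remaining values lie within 1 above the same integer.\<close>

lemma cfrac_conv_dist:
  assumes "\<forall>a\<in>sset s. a \<ge> 1"
  shows "\<bar>cfrac_conv s (2 * j + Suc p) - cfrac_conv s (2 * j + Suc q)\<bar> \<le> (1 / 4) ^ j"
  using assms
proof (induction j arbitrary: s)
  case 0
  have stl: "\<forall>a\<in>sset (stl s). a \<ge> 1" using 0 by (metis stl_sset)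
  have "0 \<le> 1 / cfrac_conv (stl s) k" "1 / cfrac_conv (stl s) k \<le> 1" for k
    using cfrac_conv_ge_1[OF stl, of k] by simp_all
  from this[of p] this[of q] have "\<bar>1 / cfrac_conv (stl s) p - 1 / cfrac_conv (stl s) q\<bar> \<le> 1"
    by linarith
  then show ?case by simp
next
  case (Suc j)
  let ?u = "stl (stl s)"
  have u: "\<forall>a\<in>sset ?u. a \<ge> 1" using Suc.prems by (metis stl_sset)
  have hd: "shd (stl s) \<ge> 1" using Suc.prems by (metis stl_sset shd_sset)
  let ?x = "cfrac_conv ?u (2 * j + Suc p)" and ?y = "cfrac_conv ?u (2 * j + Suc q)"
  have "\<bar>cfrac_conv s (2 * Suc j + Suc p) - cfrac_conv s (2 * Suc j + Suc q)\<bar>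
      = \<bar>1 / (of_int (shd (stl s)) + 1 / ?x) - 1 / (of_int (shd (stl s)) + 1 / ?y)\<bar>"
    by simp
  also have "\<dots> \<le> \<bar>?x - ?y\<bar> / 4"
    using hd by (intro cfrac_step_contraction cfrac_conv_ge_1 u) simp
  also have "\<dots> \<le> (1 / 4) ^ Suc j"
    using Suc.IH[OF u] by simp
  finally show ?case .
qed

lemma convergent_cfrac_conv:
  assumes "\<forall>a\<in>sset s. a \<ge> 1"
  shows "convergent (cfrac_conv s)"
proof (rule Cauchy_convergent, rule metric_CauchyI)
  fix e :: real assume "e > 0"
  then obtain j where j: "(1 / 4) ^ j < e"
    using real_arch_pow_inv[of e "1 / 4"] by auto
  show "\<exists>M. \<forall>m\<ge>M. \<forall>n\<ge>M. dist (cfrac_conv s m) (cfrac_conv s n) < e"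
  proof (intro exI allI impI)
    fix m n assume "m \<ge> 2 * j + 1" "n \<ge> 2 * j + 1"
    then obtain p q where "m = 2 * j + Suc p" "n = 2 * j + Suc q"
      by (metis le_Suc_ex add.assoc plus_1_eq_Suc)
    then show "dist (cfrac_conv s m) (cfrac_conv s n) < e"
      using cfrac_conv_dist[OF assms, of j p q] j by (simp only: dist_real_def)
  qed
qed

lemma cfrac_conv_tendsto:
  assumes "\<forall>a\<in>sset s. a \<ge> 1"
  shows "cfrac_conv s \<longlonglongrightarrow> cfrac s"
  using convergent_cfrac_conv[OF assms] by (simp add: cfrac_def convergent_LIMSEQ_iff)

lemma cfrac_ge_1:
  assumes "\<forall>a\<in>sset s. a \<ge> 1"
  shows "cfrac s \<ge> 1"
  using LIMSEQ_le_const[OF cfrac_conv_tendsto[OF assms]] cfrac_conv_ge_1[OF assms] by blast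

section \<open>Values under prepending of partial quotients\<close>

lemma cfrac_Stream:
  assumes "a \<ge> 1" and "\<forall>a\<in>sset s. a \<ge> 1"
  shows "cfrac (a ## s) = of_int a + 1 / cfrac s"
proof (rule LIMSEQ_unique)
  have "\<forall>x\<in>sset (a ## s). x \<ge> 1" using assms by simp
  then show "(\<lambda>k. cfrac_conv (a ## s) (Suc k)) \<longlonglongrightarrow> cfrac (a ## s)"
    by (intro LIMSEQ_Suc cfrac_conv_tendsto)
  show "(\<lambda>k. cfrac_conv (a ## s) (Suc k)) \<longlonglongrightarrow> of_int a + 1 / cfrac s"
    using cfrac_ge_1[OF assms(2)]
    by (auto intro!: tendsto_intros cfrac_conv_tendsto assms(2))
qed

text \<open>Prepending a 1 is the Moebius map of the matrix with rows (1, 1) and (1, 0), whose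
  powers have Fibonacci entries. The last entry, of index \<open>k - 1\<close>, is written as a
  difference so that \<open>k = 0\<close> is covered.\<close>

lemma cfrac_replicate_1:
  assumes "\<forall>a\<in>sset s. a \<ge> 1"
  shows "cfrac (replicate k 1 @- s) =
    (real (fib (Suc k)) * cfrac s + real (fib k)) /
    (real (fib k) * cfrac s + real (fib (Suc k)) - real (fib k))"
proof (induction k)
  case 0
  then show ?case by simp
next
  case (Suc k)
  let ?x = "cfrac s" and ?f = "real (fib (Suc k))" and ?g = "real (fib k)"
  have x: "?x \<ge> 1" by (rule cfrac_ge_1[OF assms])
  have f: "?f > 0" by (simp add: fib_neq_0_nat)
  have pos: "?f * ?x + ?g > 0" using x f by (intro add_pos_nonneg) auto
  have "cfrac (replicate (Suc k) 1 @- s) = 1 + 1 / cfrac (replicate k 1 @- s)"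
    using assms by (subst replicate_Suc, subst shift.simps, subst cfrac_Stream) auto
  also have "\<dots> = 1 + (?g * ?x + ?f - ?g) / (?f * ?x + ?g)"
    by (simp add: Suc.IH)
  also have "\<dots> = ((?f + ?g) * ?x + ?f) / (?f * ?x + ?g)"
    using pos by (simp add: field_simps)
  finally show ?case by simp
qed

section \<open>The quadratic equation of \<open>lam\<close>\<close>

lemma fib_like_Suc_Suc: "fib_like m (Suc (Suc k)) = m * fib (Suc k) + fib k"
proof -
  \<comment> \<open>The recurrence reaches two terms back, so two consecutive values go through the
    induction.\<close>
  have "fib_like m (Suc (Suc k)) = m * fib (Suc k) + fib k \<and>
    fib_like m (Suc (Suc (Suc k))) = m * fib (Suc (Suc k)) + fib (Suc k)"
    by (induction k) (simp_all add: algebra_simps)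
  then show ?thesis ..
qed

text \<open>With \<open>n = Suc k\<close>, \<open>a k - b k\<close> stands for the Fibonacci number
  of index \<open>n - 2\<close>, which also makes sense for \<open>n = 1\<close>.\<close>

lemma lam_quadratic:
  assumes "N \<ge> 1"
  defines "a k \<equiv> real (fib (Suc k))" and "b k \<equiv> real (fib k)"
  shows "(lam (Suc k) N)\<^sup>2 = 2 * real N * a k * lam (Suc k) N + a k * (2 * real N * b k + a k - b k)"
proof -
  let ?s = "lam_quotients (Suc k) N"
  let ?x = "cfrac ?s"
  have ge: "\<forall>a\<in>sset ?s. a \<ge> 1"
    using assms(1) by (auto simp: lam_quotients_def)
  have "?s = 2 * int N ## (replicate k 1 @- ?s)"
    unfolding lam_quotients_def by (subst cycle_decomp) auto
  then have "?x = cfrac (2 * int N ## (replicate k 1 @- ?s))"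
    by simp
  also have "\<dots> = 2 * N + 1 / cfrac (replicate k 1 @- ?s)"
    using ge assms(1) by (subst cfrac_Stream) auto
  also have "\<dots> = 2 * N + (b k * ?x + a k - b k) / (a k * ?x + b k)"
    using ge by (simp add: cfrac_replicate_1 a_def b_def)
  finally have eq: "?x = 2 * N + (b k * ?x + a k - b k) / (a k * ?x + b k)" .
  have "a k * ?x + b k > 0"
    using cfrac_ge_1[OF ge] unfolding a_def b_def
    by (intro add_pos_nonneg mult_pos_pos) (auto simp: fib_neq_0_nat)
  with eq have "?x * (a k * ?x + b k) = 2 * N * (a k * ?x + b k) + (b k * ?x + a k - b k)"
    by (metis (no_types, lifting) distrib_right nonzero_eq_divide_eq less_irrefl)
  then have "a k * ?x\<^sup>2 = 2 * N * a k * ?x + 2 * N * b k + a k - b k"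
    by (simp add: algebra_simps power2_eq_square)
  \<comment> \<open>The factor \<open>a k\<close> turns the equation for \<open>?x\<close> into a
    monic one for \<open>lam (Suc k) N = a k * ?x\<close>; integrality rests on this.\<close>
  then have "a k * (a k * ?x\<^sup>2) = a k * (2 * N * a k * ?x + 2 * N * b k + a k - b k)"
    by simp
  then show ?thesis
    by (simp add: lam_def a_def algebra_simps power2_eq_square)
qed

text \<open>This singles out the larger root of the quadratic equation: the continued fraction even
  exceeds \<open>2 * N\<close>.\<close>

lemma lam_gt:
  assumes "N \<ge> 1"
  shows "lam (Suc k) N > real N * real (fib (Suc k))"
proof -
  let ?s = "lam_quotients (Suc k) N" and ?t = "replicate k 1 @- lam_quotients (Suc k) N"
  have ge: "\<forall>a\<in>sset ?t. a \<ge> 1"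
    using assms by (auto simp: lam_quotients_def)
  have "?s = 2 * int N ## ?t"
    unfolding lam_quotients_def by (subst cycle_decomp) auto
  then have "cfrac ?s = 2 * N + 1 / cfrac ?t"
    using cfrac_Stream[OF _ ge, of "2 * int N"] assms by simp
  then have "cfrac ?s > N"
    using cfrac_ge_1[OF ge] by (simp add: add_nonneg_pos)
  moreover have "fib (Suc k) > 0" by (simp add: fib_neq_0_nat)
  ultimately show ?thesis
    by (simp add: lam_def mult.commute)
qed

lemma lam_completed_square:
  assumes "N \<ge> 1"
  shows "(lam (Suc k) N - real N * real (fib (Suc k)))\<^sup>2 =
    (real (fib_like N (Suc (Suc k))))\<^sup>2 + (-1) ^ k"
proof -
  \<comment> \<open>With a, b the Fibonacci numbers of index \<open>Suc k\<close> and
    \<open>k\<close>, completing the square leaves \<open>a^2 - a b - b^2\<close> beside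
    \<open>(N a + b)^2\<close>; Cassini evaluates it to \<open>(-1) ^ k\<close>.\<close>
  have "real_of_int (int (fib (Suc (Suc k)) * fib k) - int ((fib (Suc k))\<^sup>2)) = - ((-1) ^ k)"
    by (subst fib_Cassini_int) simp
  then have "(real (fib (Suc k)) + fib k) * fib k - (real (fib (Suc k)))\<^sup>2 = - ((-1) ^ k)"
    by simp
  with lam_quadratic[OF assms, of k] show ?thesis
    unfolding fib_like_Suc_Suc by (simp add: algebra_simps power2_eq_square)
qed

lemma algebraic_int_lam:
  assumes "N \<ge> 1"
  shows "algebraic_int (lam (Suc k) N)"
proof -
  define a b :: int where "a = int (fib (Suc k))" and "b = int (fib k)"
  define p :: "real poly" where
    "p = [:- of_int (a * (2 * int N * b + a - b)), - of_int (2 * int N * a), 1:]"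
  have "poly p (lam (Suc k) N) = 0"
    using lam_quadratic[OF assms, of k]
    by (simp add: p_def a_def b_def algebra_simps power2_eq_square)
  moreover have "lead_coeff p = 1" by (simp add: p_def)
  moreover have "coeff p i \<in> \<int>" for i
    unfolding p_def coeff_pCons by (auto split: nat.split)
  ultimately show ?thesis
    by (intro algebraic_int.intros[of p]) auto
qed

section \<open>The two periodic expansions\<close>

lemma lam_eqI:
  assumes "N \<ge> 1" and "x > real N * real (fib (Suc k))"
    and "(x - real N * real (fib (Suc k)))\<^sup>2 = (real (fib_like N (Suc (Suc k))))\<^sup>2 + (-1) ^ k"
  shows "x = lam (Suc k) N"
  using power2_eq_imp_eq[of "x - real N * real (fib (Suc k))" "lam (Suc k) N - real N * real (fib (Suc k))"]
    lam_completed_square[OF assms(1), of k] lam_gt[OF assms(1), of k] assms by simp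

text \<open>The integer part in both expansions is thus the centre of the completed square plus
  \<open>T\<close>, up to the shift by 1 for even n.\<close>

lemma fib_like_double: "real (fib_like (2 * N) (Suc (Suc k))) =
    real N * real (fib (Suc k)) + real (fib_like N (Suc (Suc k)))"
  by (simp add: fib_like_Suc_Suc)

lemma lam_odd_expansion:
  assumes "N \<ge> 1" and "even k"
  shows "cfrac_conv ([int (fib_like (2 * N) (Suc (Suc k)))] @- cycle [2 * int (fib_like N (Suc (Suc k)))])
    \<longlonglongrightarrow> lam (Suc k) N"
proof -
  define T where "T = fib_like N (Suc (Suc k))"
  define A where "A = fib_like (2 * N) (Suc (Suc k))"
  have "fib (Suc k) > 0" by (simp add: fib_neq_0_nat)
  then have T: "T \<ge> 1" and A: "A \<ge> 1"
    using assms(1) by (auto simp: T_def A_def fib_like_Suc_Suc Suc_le_eq)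
  define s where "s = cycle [2 * int T]"
  have s: "\<forall>a\<in>sset s. a \<ge> 1"
    using T by (simp add: s_def)
  have As: "\<forall>a\<in>sset (int A ## s). a \<ge> 1"
    using s A by simp
  define u where "u = 1 / cfrac s"
  have u: "u > 0" using cfrac_ge_1[OF s] by (simp add: u_def)
  have "s = 2 * int T ## s"
    unfolding s_def by (subst cycle_decomp) auto
  then have "cfrac s = 2 * T + u"
    using cfrac_Stream[OF _ s, of "2 * int T"] T by (simp add: u_def)
  then have "u * (2 * T + u) = 1"
    using u by (simp add: u_def)
  \<comment> \<open>Periodicity gave \<open>u^2 + 2 T u = 1\<close>; adding \<open>T^2\<close>
    completes the square.\<close>
  then have "(T + u)\<^sup>2 = (real T)\<^sup>2 + 1"
    by (simp add: algebra_simps power2_eq_square)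
  moreover have "cfrac (int A ## s) = N * fib (Suc k) + (T + u)"
    using cfrac_Stream[OF _ s, of "int A"] A fib_like_double[of N k]
    by (simp add: u_def A_def T_def)
  ultimately have "cfrac (int A ## s) = lam (Suc k) N"
    using u assms T by (intro lam_eqI) (auto simp: T_def add_nonneg_pos)
  then show ?thesis
    using cfrac_conv_tendsto[OF As] by (simp add: s_def A_def T_def)
qed

lemma lam_even_expansion:
  assumes "N \<ge> 1" and "odd k"
  shows "cfrac_conv ([int (fib_like (2 * N) (Suc (Suc k))) - 1]
      @- cycle [1, 2 * int (fib_like N (Suc (Suc k))) - 2]) \<longlonglongrightarrow> lam (Suc k) N"
proof -
  define T where "T = fib_like N (Suc (Suc k))"
  define A where "A = fib_like (2 * N) (Suc (Suc k))"
  \<comment> \<open>Odd \<open>k\<close> excludes \<open>k = 0\<close>. Hence \<open>T\<close> is at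
    least 2, and the quotient \<open>2 * T - 2\<close> is positive.\<close>
  have "fib (Suc k) > 0" "fib k > 0"
    using \<open>odd k\<close> by (auto simp: fib_neq_0_nat odd_pos)
  then have "N * fib (Suc k) \<ge> 1" "fib k \<ge> 1"
    using assms(1) by (simp_all del: fib.simps add: Suc_le_eq)
  then have T: "T \<ge> 2" and A: "A \<ge> 2"
    unfolding T_def A_def fib_like_Suc_Suc by linarith+
  define s where "s = cycle [1, 2 * int T - 2]"
  have s: "\<forall>a\<in>sset s. a \<ge> 1"
    using T by (simp add: s_def)
  have As: "\<forall>a\<in>sset ((int A - 1) ## s). a \<ge> 1"
    using s A by simp
  define u where "u = 1 / cfrac s"
  have u: "u > 0" using cfrac_ge_1[OF s] by (simp add: u_def)
  have "s = 1 ## (2 * int T - 2) ## s"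
    unfolding s_def by (subst cycle_decomp) auto
  then have "cfrac s = cfrac (1 ## (2 * int T - 2) ## s)"
    by simp
  also have "\<dots> = 1 + 1 / (2 * real T - 2 + u)"
    using s T by (simp add: cfrac_Stream u_def)
  finally have eq: "cfrac s = 1 + 1 / (2 * real T - 2 + u)" .
  have "u * cfrac s = 1" using u by (simp add: u_def)
  moreover have pos: "2 * real T - 2 + u > 0" using u T by simp
  ultimately have "u * (2 * real T - 2 + u + 1) = 2 * real T - 2 + u"
    by (simp add: eq field_simps)
  \<comment> \<open>Here \<open>u^2 + (2 T - 2) u = 2 T - 2\<close>, and adding
    \<open>(T - 1)^2\<close> makes the right side \<open>T^2 - 1\<close>.\<close>
  then have "(real T - 1 + u)\<^sup>2 = (real T)\<^sup>2 - 1"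
    by (simp add: algebra_simps power2_eq_square)
  moreover have "cfrac ((int A - 1) ## s) = N * fib (Suc k) + (real T - 1 + u)"
    using cfrac_Stream[OF _ s, of "int A - 1"] A fib_like_double[of N k]
    by (simp add: u_def A_def T_def)
  ultimately have "cfrac ((int A - 1) ## s) = lam (Suc k) N"
    using u assms T by (intro lam_eqI) (auto simp: T_def add_nonneg_pos)
  then show ?thesis
    using cfrac_conv_tendsto[OF As] by (simp add: s_def A_def T_def)
qed

text \<open>The expansions are stated as limits because \<open>cfrac\<close> is unspecified without
  convergence; for the same reason convergence of the fraction defining \<open>lam\<close> is
  asserted as well.\<close>

theorem theorem3:
  fixes N n :: nat
  assumes "N \<ge> 1" and "n \<ge> 1"
  shows "convergent (cfrac_conv (lam_quotients n N)) \<and>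
    algebraic_int (lam n N) \<and>
    (odd n \<longrightarrow>
      cfrac_conv ([int (fib_like (2 * N) (n + 1))]
          @- cycle [2 * int (fib_like N (n + 1))])
        \<longlonglongrightarrow> lam n N) \<and>
    (even n \<longrightarrow>
      cfrac_conv ([int (fib_like (2 * N) (n + 1)) - 1]
          @- cycle [1, 2 * int (fib_like N (n + 1)) - 2])
        \<longlonglongrightarrow> lam n N)"
proof -
  \<comment> \<open>The shift swaps parities: odd \<open>n\<close> is the case of even
    \<open>k\<close>.\<close>
  obtain k where n: "n = Suc k"
    using assms(2) by (cases n) auto
  have "convergent (cfrac_conv (lam_quotients n N))"
    using assms(1) by (intro convergent_cfrac_conv) (auto simp: lam_quotients_def)
  moreover have "algebraic_int (lam n N)"
    using algebraic_int_lam[OF assms(1)] by (simp add: n)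
  ultimately show ?thesis
    using lam_odd_expansion[OF assms(1), of k] lam_even_expansion[OF assms(1), of k]
    by (simp only: n Suc_eq_plus1[symmetric] even_Suc) blast
qed

end
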